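(* Let $N$ be a square-free positive integer of the form $2p$, $3p$, $5p$, $6p$ or $7p$ for some prime $p$. Then all principal minors of the Fourier matrix $\mathcal{F}_N$ are non-zero, i.e. for every $K\subset\mathbb{Z}_N$ the determinant of the submatrix $\mathcal{F}_N[K,K]$ is non-zero.
   Context: For $N\in\mathbb{N}$, the Fourier matrix of order $N$ is $\mathcal{F}_N=(\omega^{ij})_{0\le i,j\le N-1}\in\mathbb{C}^{N\times N}$ with $\omega=e^{-2\pi i/N}$. Rows and columns are indexed by $\mathbb{Z}_N=\{0,\dots,N-1\}$; for $K,L\subset\mathbb{Z}_N$ with $|K|=|L|$, $\mathcal{F}_N[K,L]$ is the submatrix with rows indexed by $K$ and columns indexed by $L$. A principal minor is $\det\mathcal{F}_N[K,K]$. An integer $N\in\mathbb N$ is square-free if it is divisible by no square number other than $1$. *)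

theory Defs
  imports Complex_Main "HOL-Computational_Algebra.Squarefree"
    "Jordan_Normal_Form.Determinant" "Jordan_Normal_Form.DL_Submatrix"
begin

definition fourier_matrix :: "nat \<Rightarrow> complex mat" where
  "fourier_matrix N =
     mat N N (\<lambda>(i, j). exp (- (2 * complex_of_real pi * \<i> / of_nat N)) ^ (i * j))"

end

theory Submission
  imports Defs "Jordan_Normal_Form.Char_Poly"
begin

text \<open>Write \<open>N = m p\<close> and \<open>\<zeta>\<^sub>N = \<eta> \<omega>\<close> with \<open>\<eta>\<close>, \<open>\<omega>\<close> primitive of orders \<open>m\<close>, \<open>p\<close>. Let \<open>v\<close> be in the
  kernel of a principal submatrix, \<open>W\<close> the \<open>\<int>[\<zeta>\<^sub>N]\<close>-module generated by its entries and
  \<open>J = (1 - \<omega>) W\<close>. For every residue \<open>r\<close> modulo \<open>m\<close>, the polynomial with coefficients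
  \<open>\<eta>\<^bsup>r j\<^esup> v\<^sub>j\<close> vanishes at \<open>\<omega>\<^bsup>i\<^esup>\<close> for all \<open>i \<in> K\<close> in the class of \<open>r\<close>; as \<open>\<omega>\<close> is congruent to 1, it is
  modulo \<open>J\<close> divisible by the corresponding power of \<open>X - 1\<close>. Comparing moments class by class
  reduces everything to principal minors of the Fourier matrix of order \<open>m\<close>, which are units
  modulo \<open>J\<close>. Hence \<open>W = (1 - \<omega>) W\<close>, so \<open>W = p W\<close> because \<open>p\<close> divides \<open>(1 - \<omega>)\<^bsup>p\<^esup>\<close>, and the finitely
  generated group \<open>W\<close> is zero. For \<open>m = 7\<close> some \<open>3 \<times> 3\<close> minors are divisible by primes over 2, so
  \<open>N = 14\<close> has to be treated as \<open>2 \<sqdot> 7\<close>.\<close>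

section \<open>Roots of unity\<close>

text \<open>Exact multiplicative order, phrased by divisibility so that it makes sense in any
  domain. For \<open>m = 0\<close> it means infinite order or \<open>x = 0\<close>, hence the
  recurring hypothesis \<open>m > 0\<close>.\<close>

definition root_of_order :: "nat \<Rightarrow> 'a::idom \<Rightarrow> bool" where
  "root_of_order m x \<longleftrightarrow> (\<forall>k. x ^ k = 1 \<longleftrightarrow> m dvd k)"

lemma root_of_order_power: "root_of_order m x \<Longrightarrow> x ^ m = 1"
  by (simp add: root_of_order_def)

lemma power_mod_exponent:
  fixes x :: "'a::monoid_mult"
  assumes "x ^ m = 1"
  shows "x ^ (k mod m) = x ^ k"
proof -
  have "x ^ k = x ^ (m * (k div m) + k mod m)" by simp
  then show ?thesis unfolding power_add power_mult assms by simp
qed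

lemma root_of_order_eq_iff:
  assumes "root_of_order m x" "m > 0"
  shows "x ^ i = x ^ j \<longleftrightarrow> int m dvd int i - int j"
proof -
  have x0: "x \<noteq> 0"
    using root_of_order_power[OF assms(1)] assms(2) by (auto simp: power_0_left)
  have aux: "x ^ i = x ^ j \<longleftrightarrow> int m dvd int i - int j" if "j \<le> i" for i j
  proof -
    have "x ^ i = x ^ j * x ^ (i - j)"
      using that by (simp flip: power_add)
    then have "x ^ i = x ^ j \<longleftrightarrow> x ^ (i - j) = 1"
      using x0 by auto
    also have "\<dots> \<longleftrightarrow> int m dvd int i - int j"
      using assms(1) that by (simp add: root_of_order_def of_nat_diff[symmetric] del: of_nat_diff)
    finally show ?thesis .
  qed
  show ?thesis
  proof (cases "j \<le> i")
    case False
    then show ?thesis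
      using aux[of i j] by (subst eq_commute) (simp add: dvd_diff_commute)
  qed (simp add: aux)
qed

text \<open>Giving the inverse as an explicit power of \<open>x\<close> lets it inherit closure
  properties, such as being a multiplier.\<close>

lemma root_of_order_inverse:
  assumes "root_of_order m x" "m > 0"
  obtains y where "root_of_order m y" "y * x = 1" "y = x ^ (m - 1)"
proof
  let ?y = "x ^ (m - 1)"
  show 1: "?y * x = 1"
    using assms root_of_order_power[OF assms(1)] by (cases m) (auto simp: mult.commute)
  have "?y ^ k * x ^ k = 1" for k
    by (metis 1 power_mult_distrib power_one)
  then have "?y ^ k = 1 \<longleftrightarrow> x ^ k = 1" for k
    by (metis mult_1 mult_1_right)
  then show "root_of_order m ?y"
    using assms(1) by (simp add: root_of_order_def)
qed simp

lemma sum_powers_root: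
  fixes x :: "'a::idom"
  assumes "x ^ m = 1" "x \<noteq> 1"
  shows "(\<Sum>k<m. x ^ k) = 0"
proof -
  have "(1 - x) * (\<Sum>k<m. x ^ k) = 0"
    using assms(1) by (simp flip: one_diff_power_eq)
  then show ?thesis
    using assms(2) by simp
qed

text \<open>The numbers \<open>1 - x ^ k\<close> for \<open>k < m\<close> sum to \<open>m\<close>,
  and each is divisible by \<open>1 - x\<close>. This makes \<open>p\<close> a multiple of
  \<open>1 - \<omega>\<close> and differences of roots of unity divisors of
  \<open>m\<close>.\<close>

lemma one_minus_root_dvd_order:
  fixes x :: "'a::idom"
  assumes "x ^ m = 1" "x \<noteq> 1"
  shows "of_nat m = (1 - x) * (\<Sum>k<m. \<Sum>i<k. x ^ i)"
proof -
  have "(1 - x) * (\<Sum>k<m. \<Sum>i<k. x ^ i) = (\<Sum>k<m. 1 - x ^ k)"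
    by (simp add: sum_distrib_left one_diff_power_eq)
  also have "\<dots> = of_nat m"
    by (simp add: sum_subtractf sum_powers_root[OF assms])
  finally show ?thesis by simp
qed

text \<open>Turns sparse polynomials into coefficient lists, so that simplification can check the
  certificate identities.\<close>

lemma monom_small:
  "monom c 2 = [:0, 0, c:]" "monom c 3 = [:0, 0, 0, c:]" "monom c 4 = [:0, 0, 0, 0, c:]"
  "monom c 5 = [:0, 0, 0, 0, 0, c:]" "monom c 6 = [:0, 0, 0, 0, 0, 0, c:]"
  for c :: int
  by (simp_all add: monom_Suc numeral_eq_Suc monom_0)

section \<open>Linear algebra modulo a submodule\<close>

text \<open>The quotient of \<open>W\<close> by \<open>J\<close> is never formed; congruences modulo
  \<open>J\<close> are expressed as membership in \<open>J\<close>.\<close>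

locale submodule_pair =
  fixes W J :: "'a::idom set"
  assumes J_subset: "J \<subseteq> W"
    and zero_J: "0 \<in> J"
    and diff_W: "\<And>x y. x \<in> W \<Longrightarrow> y \<in> W \<Longrightarrow> x - y \<in> W"
    and diff_J: "\<And>x y. x \<in> J \<Longrightarrow> y \<in> J \<Longrightarrow> x - y \<in> J"
begin

text \<open>The scalars that act on the quotient of \<open>W\<close> by \<open>J\<close>.\<close>

definition multipliers :: "'a set" where
  "multipliers = {a. (\<forall>w\<in>W. a * w \<in> W) \<and> (\<forall>w\<in>J. a * w \<in> J)}"

text \<open>The scalars that act injectively on the quotient; regularity of a determinant replaces
  its being nonzero.\<close>

definition regulars :: "'a set" where
  "regulars = {a \<in> multipliers. \<forall>w\<in>W. a * w \<in> J \<longrightarrow> w \<in> J}"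

text \<open>Injectivity, on vectors over the quotient of \<open>W\<close> by \<open>J\<close>, of
  the principal submatrix on \<open>S\<close> of the Fourier matrix built from
  \<open>\<eta>\<close>.\<close>

definition kernel_free :: "'a \<Rightarrow> nat set \<Rightarrow> bool" where
  "kernel_free \<eta> S \<longleftrightarrow> (\<forall>c. (\<forall>s\<in>S. c s \<in> W) \<longrightarrow>
     (\<forall>r\<in>S. (\<Sum>s\<in>S. \<eta> ^ (r * s) * c s) \<in> J) \<longrightarrow> (\<forall>s\<in>S. c s \<in> J))"

section \<open>Closure properties of submodules, multipliers and regular elements\<close>

lemma zero_W: "0 \<in> W"
  using zero_J J_subset by blast

lemma add_W: "x \<in> W \<Longrightarrow> y \<in> W \<Longrightarrow> x + y \<in> W"
  using diff_W[of x "0 - y"] diff_W[of 0 y] zero_W by simp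

lemma add_J: "x \<in> J \<Longrightarrow> y \<in> J \<Longrightarrow> x + y \<in> J"
  using diff_J[of x "0 - y"] diff_J[of 0 y] zero_J by simp

lemma sum_W: "(\<And>i. i \<in> A \<Longrightarrow> f i \<in> W) \<Longrightarrow> sum f A \<in> W"
  by (induction A rule: infinite_finite_induct) (auto intro: zero_W add_W)

lemma sum_J: "(\<And>i. i \<in> A \<Longrightarrow> f i \<in> J) \<Longrightarrow> sum f A \<in> J"
  by (induction A rule: infinite_finite_induct) (auto intro: zero_J add_J)

lemma multipliers_W: "a \<in> multipliers \<Longrightarrow> w \<in> W \<Longrightarrow> a * w \<in> W"
  and multipliers_J: "a \<in> multipliers \<Longrightarrow> w \<in> J \<Longrightarrow> a * w \<in> J"
  by (simp_all add: multipliers_def)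

lemma regularsD: "a \<in> regulars \<Longrightarrow> w \<in> W \<Longrightarrow> a * w \<in> J \<Longrightarrow> w \<in> J"
  by (simp add: regulars_def)

lemma multipliers_0: "0 \<in> multipliers"
  by (simp add: multipliers_def zero_J zero_W)

lemma multipliers_1: "1 \<in> multipliers"
  by (simp add: multipliers_def)

lemma multipliers_diff: "a \<in> multipliers \<Longrightarrow> b \<in> multipliers \<Longrightarrow> a - b \<in> multipliers"
  by (simp add: multipliers_def left_diff_distrib diff_J diff_W)

lemma multipliers_add: "a \<in> multipliers \<Longrightarrow> b \<in> multipliers \<Longrightarrow> a + b \<in> multipliers"
  by (simp add: multipliers_def distrib_right add_J add_W)

lemma multipliers_mult: "a \<in> multipliers \<Longrightarrow> b \<in> multipliers \<Longrightarrow> a * b \<in> multipliers"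
  by (simp add: multipliers_def mult.assoc)

lemma multipliers_power: "a \<in> multipliers \<Longrightarrow> a ^ n \<in> multipliers"
  by (induction n) (simp_all add: multipliers_1 multipliers_mult)

lemma multipliers_of_nat: "of_nat n \<in> multipliers"
  by (induction n) (simp_all add: multipliers_0 multipliers_1 multipliers_add)

lemma multipliers_of_int: "of_int n \<in> multipliers"
proof (cases n rule: int_cases2)
  case (nonneg k)
  then show ?thesis by (simp add: multipliers_of_nat)
next
  case (nonpos k)
  then show ?thesis
    using multipliers_diff[OF multipliers_0 multipliers_of_nat[of k]] by simp
qed

lemma multipliers_numeral: "numeral n \<in> multipliers"
  using multipliers_of_nat[of "numeral n"] by simp

lemma multipliers_uminus: "a \<in> multipliers \<Longrightarrow> - a \<in> multipliers"
  using multipliers_diff[OF multipliers_0] by simp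

lemma multipliers_sum: "(\<And>i. i \<in> A \<Longrightarrow> f i \<in> multipliers) \<Longrightarrow> sum f A \<in> multipliers"
  by (induction A rule: infinite_finite_induct) (auto intro: multipliers_0 multipliers_add)

lemmas multipliers_intros =
  multipliers_0 multipliers_1 multipliers_diff multipliers_add multipliers_mult
  multipliers_power multipliers_of_nat multipliers_of_int multipliers_numeral
  multipliers_uminus multipliers_sum

lemma regulars_factor:
  assumes "a * b \<in> regulars" "a \<in> multipliers" "b \<in> multipliers"
  shows "b \<in> regulars"
  using assms unfolding regulars_def by (auto simp: mult.assoc intro: multipliers_J)

lemma regulars_mult:
  assumes "a \<in> regulars" "b \<in> regulars"
  shows "a * b \<in> regulars"
  using assms unfolding regulars_def
  by (auto simp: mult.assoc intro!: multipliers_mult multipliers_W)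

lemma regulars_1: "1 \<in> regulars"
  by (simp add: regulars_def multipliers_1)

lemma regulars_root: "x ^ m = 1 \<Longrightarrow> m > 0 \<Longrightarrow> x \<in> multipliers \<Longrightarrow> x ^ k \<in> regulars"
proof -
  assume a: "x ^ m = 1" "m > 0" "x \<in> multipliers"
  have "x \<in> regulars"
    by (rule regulars_factor[of "x ^ (m - 1)"])
      (use a in \<open>simp_all add: regulars_1 multipliers_power flip: power_Suc2\<close>)
  then show "x ^ k \<in> regulars"
    by (induction k) (simp_all add: regulars_1 regulars_mult)
qed

lemma kernel_free_root_sum:
  assumes "\<eta> \<in> multipliers" and "\<And>s. s \<in> S \<Longrightarrow> c s \<in> W"
  shows "(\<Sum>s\<in>S. \<eta> ^ (r * s) * c s) \<in> W"
  using assms by (intro sum_W multipliers_W multipliers_power) auto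

text \<open>Multiplying by \<open>x j - x a\<close> for a fixed node \<open>x a\<close> eliminates that node and one moment.\<close>

lemma vandermonde_mod:
  assumes "finite A"
    and "\<And>j. j \<in> A \<Longrightarrow> v j \<in> W"
    and "\<And>j. j \<in> A \<Longrightarrow> x j \<in> multipliers"
    and "\<And>i j. i \<in> A \<Longrightarrow> j \<in> A \<Longrightarrow> i \<noteq> j \<Longrightarrow> x i - x j \<in> regulars"
    and "\<And>n. n < card A \<Longrightarrow> (\<Sum>j\<in>A. v j * x j ^ n) \<in> J"
    and "j \<in> A"
  shows "v j \<in> J"
  using assms
proof (induction A arbitrary: v j rule: finite_induct)
  case (insert a A)
  have rest: "v j \<in> J" if "j \<in> A" for j
  proof -
    have "(x j - x a) * v j \<in> J"
    proof (rule insert.IH[of "\<lambda>j. (x j - x a) * v j"])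
      fix n assume n: "n < card A"
      have "(\<Sum>j\<in>A. (x j - x a) * v j * x j ^ n) = (\<Sum>j\<in>insert a A. (x j - x a) * v j * x j ^ n)"
        using insert.hyps by simp
      also have "\<dots> = (\<Sum>j\<in>insert a A. v j * x j ^ Suc n) - x a * (\<Sum>j\<in>insert a A. v j * x j ^ n)"
        unfolding sum_distrib_left sum_subtractf[symmetric]
        by (rule sum.cong) (simp_all add: algebra_simps)
      also have "\<dots> \<in> J"
        using n insert.hyps
        by (intro diff_J multipliers_J insert.prems) auto
      finally show "(\<Sum>j\<in>A. (x j - x a) * v j * x j ^ n) \<in> J" .
    qed (use insert.prems that in \<open>auto intro!: multipliers_W multipliers_diff\<close>)
    moreover have "x j - x a \<in> regulars" "v j \<in> W"
      using insert.prems(1,3) insert.hyps(2) that by auto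
    ultimately show ?thesis using regularsD by blast
  qed
  \<comment> \<open>Once all other entries are in \<open>J\<close>, the moment of order 0 isolates
    \<open>v a\<close>.\<close>
  have "(\<Sum>j\<in>insert a A. v j * x j ^ 0) - (\<Sum>j\<in>A. v j) \<in> J"
    using insert.hyps rest by (intro diff_J sum_J insert.prems) auto
  then have "v a \<in> J"
    using insert.hyps by simp
  then show ?case
    using rest insert.prems by auto
qed simp

section \<open>Polynomials with coefficients in \<open>W\<close> and their moments\<close>

lemma poly_W:
  assumes "\<And>i. coeff p i \<in> W" "y \<in> multipliers"
  shows "poly p y \<in> W"
  unfolding poly_altdef
  by (rule sum_W) (metis assms mult.commute multipliers_W multipliers_power)

text \<open>By Horner's scheme, each coefficient of the quotient is the value at \<open>y\<close> of
  a tail of \<open>p\<close>.\<close>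

lemma synthetic_div_W:
  assumes "\<And>i. coeff p i \<in> W" "y \<in> multipliers"
  shows "coeff (synthetic_div p y) i \<in> W"
  using assms(1)
proof (induction p arbitrary: i)
  case (pCons a p)
  have *: "coeff p i \<in> W" for i using pCons.prems[of "Suc i"] by simp
  then show ?case
    using pCons.IH poly_W[OF _ assms(2)] by (auto simp: coeff_pCons split: nat.split)
qed (simp add: zero_W)

text \<open>Splitting off a linear factor \<open>X - y\<close> with \<open>y\<close> congruent to 1 changes the moments of a
  polynomial, modulo \<open>J\<close>, as the difference operator does.\<close>

lemma moments_vanish_mod:
  assumes "finite Y"
    and "\<And>y. y \<in> Y \<Longrightarrow> y \<in> multipliers"
    and "\<And>y w. y \<in> Y \<Longrightarrow> w \<in> W \<Longrightarrow> (1 - y) * w \<in> J"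
    and "\<And>i. coeff h i \<in> W"
    and "\<And>y. y \<in> Y \<Longrightarrow> poly h y = 0"
    and "degree h \<le> D"
    and "n < card Y"
  shows "(\<Sum>j\<le>D. coeff h j * of_nat j ^ n) \<in> J"
  using assms
proof (induction Y arbitrary: h n rule: finite_induct)
  case (insert y Y)
  define q where "q = synthetic_div h y"
  have h: "h = [:-y, 1:] * q"
    using synthetic_div_correct'[of y h] insert.prems(4)[of y] by (simp add: q_def)
  have coeff_h: "coeff h 0 = - y * coeff q 0" "coeff h (Suc j) = coeff q j - y * coeff q (Suc j)" for j
    unfolding h by (simp_all add: algebra_simps)
  have qW: "coeff q i \<in> W" for i
    unfolding q_def using insert.prems by (intro synthetic_div_W) auto
  have dq: "degree q \<le> D"
    unfolding q_def degree_synthetic_div using insert.prems(5) by simp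
  \<comment> \<open>The top coefficient vanishes, so the index shift below leaves no boundary term
    at \<open>D\<close>.\<close>
  have qD: "coeff q D = 0"
  proof -
    have "coeff h (Suc D) = 0" "coeff q (Suc D) = 0"
      using insert.prems(5) dq by (auto intro: coeff_eq_0)
    then show ?thesis using coeff_h(2)[of D] by simp
  qed
  have q0: "poly q z = 0" if "z \<in> Y" for z
  proof -
    have "z \<noteq> y" using that insert.hyps by auto
    moreover have "poly h z = 0" using that insert.prems by auto
    ultimately show ?thesis unfolding h by simp
  qed
  have IH: "(\<Sum>j\<le>D. coeff q j * of_nat j ^ l) \<in> J" if "l < card Y" for l
    using insert.prems(1,2) qW q0 dq that by (intro insert.IH) auto
  have "(\<Sum>j\<le>D. coeff h j * of_nat j ^ n)
      = (\<Sum>j\<le>D. coeff q j * of_nat (Suc j) ^ n) - y * (\<Sum>j\<le>D. coeff q j * of_nat j ^ n)"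
  proof (cases D)
    case 0
    then show ?thesis using qD coeff_h(1) by simp
  next
    case (Suc D')
    have "(\<Sum>j\<le>D. coeff h j * of_nat j ^ n)
      = - y * coeff q 0 * of_nat 0 ^ n
        + (\<Sum>j\<le>D'. (coeff q j - y * coeff q (Suc j)) * of_nat (Suc j) ^ n)"
      unfolding Suc sum.atMost_Suc_shift coeff_h by simp
    also have "\<dots> = (\<Sum>j\<le>D'. coeff q j * of_nat (Suc j) ^ n)
        - y * (coeff q 0 * of_nat 0 ^ n + (\<Sum>j\<le>D'. coeff q (Suc j) * of_nat (Suc j) ^ n))"
      by (simp only: left_diff_distrib sum_subtractf sum_distrib_left distrib_left mult.assoc) simp
    also have "(\<Sum>j\<le>D'. coeff q j * of_nat (Suc j) ^ n) = (\<Sum>j\<le>D. coeff q j * of_nat (Suc j) ^ n)"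
      using qD unfolding Suc by simp
    also have "coeff q 0 * of_nat 0 ^ n + (\<Sum>j\<le>D'. coeff q (Suc j) * of_nat (Suc j) ^ n)
        = (\<Sum>j\<le>D. coeff q j * of_nat j ^ n)"
      unfolding Suc sum.atMost_Suc_shift by simp
    finally show ?thesis .
  qed
  \<comment> \<open>Replacing \<open>y\<close> by 1 costs a term in \<open>J\<close>. What remains
    is a discrete derivative of \<open>j ^ n\<close>, whose binomial expansion involves only the
    moments of \<open>q\<close> of order below \<open>n\<close>.\<close>
  also have "\<dots> = (\<Sum>j\<le>D. coeff q j * (of_nat (Suc j) ^ n - of_nat j ^ n))
      + (1 - y) * (\<Sum>j\<le>D. coeff q j * of_nat j ^ n)"
    by (simp add: right_diff_distrib left_diff_distrib sum_subtractf)
  also have "(\<Sum>j\<le>D. coeff q j * (of_nat (Suc j) ^ n - of_nat j ^ n))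
      = (\<Sum>l<n. of_nat (n choose l) * (\<Sum>j\<le>D. coeff q j * of_nat j ^ l))"
  proof -
    have "of_nat (Suc j) ^ n - of_nat j ^ n = (\<Sum>l<n. of_nat (n choose l) * (of_nat j :: 'a) ^ l)" for j
      using binomial_ring[of "of_nat j :: 'a" 1 n] by (simp add: add.commute lessThan_Suc_atMost[symmetric])
    then have "(\<Sum>j\<le>D. coeff q j * (of_nat (Suc j) ^ n - of_nat j ^ n))
      = (\<Sum>j\<le>D. \<Sum>l<n. of_nat (n choose l) * (coeff q j * of_nat j ^ l))"
      by (simp only: sum_distrib_left mult.left_commute)
    then show ?thesis
      by (subst (asm) sum.swap) (simp only: sum_distrib_left)
  qed
  also have "(\<Sum>l<n. of_nat (n choose l) * (\<Sum>j\<le>D. coeff q j * of_nat j ^ l))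
      + (1 - y) * (\<Sum>j\<le>D. coeff q j * of_nat j ^ n) \<in> J"
  proof (rule add_J)
    show "(\<Sum>l<n. of_nat (n choose l) * (\<Sum>j\<le>D. coeff q j * of_nat j ^ l)) \<in> J"
      using insert.prems(6) insert.hyps
      by (intro sum_J multipliers_J multipliers_of_nat IH) auto
    show "(1 - y) * (\<Sum>j\<le>D. coeff q j * of_nat j ^ n) \<in> J"
    proof (rule insert.prems(2))
      show "(\<Sum>j\<le>D. coeff q j * of_nat j ^ n) \<in> W"
        by (rule sum_W) (metis qW mult.commute multipliers_W multipliers_power multipliers_of_nat)
    qed simp
  qed
  finally show ?case .
qed simp

section \<open>Principal minors of size at most three, and complements\<close>

lemma kernel_free_1: "x ^ m = 1 \<Longrightarrow> m > 0 \<Longrightarrow> x \<in> multipliers \<Longrightarrow> kernel_free x {a}"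
  unfolding kernel_free_def by (auto intro: regularsD[OF regulars_root])

text \<open>The determinant is \<open>x ^ (a * a + b * b) - x ^ (2 * a * b)\<close>, which is a
  power of \<open>x\<close> times the element assumed regular.\<close>

lemma kernel_free_2:
  assumes x: "x ^ m = 1" "m > 0" "x \<in> multipliers"
    and ab: "a < b" and reg: "x ^ ((b - a) ^ 2) - 1 \<in> regulars"
  shows "kernel_free x {a, b}"
  unfolding kernel_free_def
proof (intro allI impI)
  fix c
  assume cW: "\<forall>s\<in>{a, b}. c s \<in> W"
    and cJ: "\<forall>r\<in>{a, b}. (\<Sum>s\<in>{a, b}. x ^ (r * s) * c s) \<in> J"
  obtain d where b: "b = a + d"
    using ab less_imp_add_positive by metis
  let ?D = "x ^ (2 * a * b) * (x ^ (d ^ 2) - 1)"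
  have D: "?D \<in> regulars"
    using reg b regulars_root[OF x] by (intro regulars_mult) auto
  have det: "x ^ (a * a) * x ^ (b * b) - x ^ (a * b) * x ^ (a * b) = ?D"
  proof -
    have exponents: "a * a + b * b = 2 * a * b + d ^ 2" "a * b + a * b = 2 * a * b"
      unfolding b by (simp_all add: algebra_simps power2_eq_square)
    show ?thesis
      unfolding power_add[symmetric] right_diff_distrib exponents mult_1_right ..
  qed
  have L: "x ^ (a * a) * c a + x ^ (a * b) * c b \<in> J" (is "?L \<in> J")
    "x ^ (a * b) * c a + x ^ (b * b) * c b \<in> J" (is "?M \<in> J")
    using cJ ab by (simp_all add: mult.commute[of b a])
  \<comment> \<open>Cramer's rule without division: the adjugate is applied to the two
    congruences.\<close>
  have "x ^ (b * b) * ?L - x ^ (a * b) * ?M \<in> J" "x ^ (a * a) * ?M - x ^ (a * b) * ?L \<in> J"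
    using L x by (intro diff_J multipliers_J multipliers_power; simp)+
  moreover have "x ^ (b * b) * ?L - x ^ (a * b) * ?M = ?D * c a"
    "x ^ (a * a) * ?M - x ^ (a * b) * ?L = ?D * c b"
    unfolding det[symmetric] by (simp_all add: algebra_simps)
  ultimately have "?D * c a \<in> J" "?D * c b \<in> J" by simp_all
  then show "\<forall>s\<in>{a, b}. c s \<in> J"
    using regularsD[OF D] cW by auto
qed

text \<open>The determinant of the submatrix of the Fourier matrix on \<open>{a, a + d, a + d + e}\<close>, up to a power of \<open>x\<close>.\<close>

definition triple_minor :: "'a \<Rightarrow> nat \<Rightarrow> nat \<Rightarrow> 'a" where
  "triple_minor x d e = x ^ ((d + e) ^ 2) + 2 * x ^ (d * e) - 1
     - x ^ (d ^ 2 + 2 * d * e) - x ^ (e ^ 2 + 2 * d * e)"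

lemma triple_minor_multiplier: "x \<in> multipliers \<Longrightarrow> triple_minor x d e \<in> multipliers"
  unfolding triple_minor_def by (intro multipliers_intros)

lemma triple_minor_commute: "triple_minor x d e = triple_minor x e d"
  by (simp add: triple_minor_def algebra_simps)

lemma kernel_free_3:
  assumes x: "x ^ m = 1" "m > 0" "x \<in> multipliers"
    and de: "d > 0" "e > 0"
    and reg: "triple_minor x d e \<in> regulars"
  shows "kernel_free x {a, a + d, a + d + e}"
  unfolding kernel_free_def
proof (intro allI impI)
  fix f
  define b where "b = a + d"
  define c where "c = a + d + e"
  assume fW: "\<forall>s\<in>{a, a + d, a + d + e}. f s \<in> W"
    and fJ: "\<forall>r\<in>{a, a + d, a + d + e}. (\<Sum>s\<in>{a, a + d, a + d + e}. x ^ (r * s) * f s) \<in> J"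
  have set_eq: "{a, a + d, a + d + e} = {a, b, c}"
    by (simp add: b_def c_def)
  define A B C F G H where "A = x ^ (a * a)" and "B = x ^ (b * b)" and "C = x ^ (c * c)"
    and "F = x ^ (a * b)" and "G = x ^ (a * c)" and "H = x ^ (b * c)"
  note defs = A_def B_def C_def F_def G_def H_def
  have mult: "A \<in> multipliers" "B \<in> multipliers" "C \<in> multipliers"
    "F \<in> multipliers" "G \<in> multipliers" "H \<in> multipliers"
    unfolding defs by (intro multipliers_power x)+
  define D where "D = A * B * C + 2 * F * G * H - A * H ^ 2 - B * G ^ 2 - C * F ^ 2"
  \<comment> \<open>All matrix entries are monomials in these six powers, which turns the
    determinant identity into a polynomial identity.\<close>
  define X P Q R U V where "X = x ^ (a * a)" and "P = x ^ (a * d)" and "Q = x ^ (a * e)"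
    and "R = x ^ (d * d)" and "U = x ^ (d * e)" and "V = x ^ (e * e)"
  note gens = X_def P_def Q_def R_def U_def V_def
  have monomials: "A = X" "B = X * P * P * R" "C = X * P * P * Q * Q * R * U * U * V"
    "F = X * P" "G = X * P * Q" "H = X * P * P * Q * R * U"
    "x ^ ((d + e) ^ 2) = R * U * U * V" "x ^ (d ^ 2 + 2 * d * e) = R * U * U"
    "x ^ (e ^ 2 + 2 * d * e) = V * U * U" "x ^ (a * b + b * c + a * c) = F * H * G"
    unfolding defs gens b_def c_def power_add[symmetric]
    by (rule arg_cong[where f = "power x"], simp add: algebra_simps power2_eq_square)+
  \<comment> \<open>The factor \<open>x ^ (d * e)\<close> clears the negative exponent that the term
    \<open>B * G ^ 2\<close> acquires on division by \<open>F * G * H\<close>.\<close>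
  have "x ^ (d * e) * D = x ^ (a * b + b * c + a * c) *
      triple_minor x d e"
    unfolding triple_minor_def D_def monomials U_def[symmetric]
    by (simp add: algebra_simps power2_eq_square)
  also have "\<dots> \<in> regulars"
    by (intro regulars_mult regulars_root[OF x] reg)
  finally have D: "D \<in> regulars"
    by (rule regulars_factor) (auto simp: D_def intro!: multipliers_intros mult x)
  have distinct: "a \<noteq> b" "a \<noteq> c" "b \<noteq> c"
    using de by (auto simp: b_def c_def)
  have J: "A * f a + F * f b + G * f c \<in> J" (is "?L \<in> J")
    "F * f a + B * f b + H * f c \<in> J" (is "?M \<in> J")
    "G * f a + H * f b + C * f c \<in> J" (is "?N \<in> J")
    using fJ distinct unfolding set_eq defs
    by (simp_all add: add.assoc mult.commute[of b a] mult.commute[of c a] mult.commute[of c b])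
  \<comment> \<open>The coefficients are the rows of the adjugate of the symmetric matrix with
    diagonal \<open>A\<close>, \<open>B\<close>, \<open>C\<close> and off-diagonal entries
    \<open>F\<close>, \<open>G\<close>, \<open>H\<close>.\<close>
  have "(B * C - H ^ 2) * ?L + (G * H - F * C) * ?M + (F * H - G * B) * ?N \<in> J"
    "(G * H - F * C) * ?L + (A * C - G ^ 2) * ?M + (F * G - A * H) * ?N \<in> J"
    "(F * H - G * B) * ?L + (F * G - A * H) * ?M + (A * B - F ^ 2) * ?N \<in> J"
    by (intro add_J multipliers_J multipliers_intros mult J)+
  moreover have "(B * C - H ^ 2) * ?L + (G * H - F * C) * ?M + (F * H - G * B) * ?N = D * f a"
    "(G * H - F * C) * ?L + (A * C - G ^ 2) * ?M + (F * G - A * H) * ?N = D * f b"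
    "(F * H - G * B) * ?L + (F * G - A * H) * ?M + (A * B - F ^ 2) * ?N = D * f c"
    unfolding D_def by (simp_all add: algebra_simps power2_eq_square)
  ultimately have "D * f a \<in> J" "D * f b \<in> J" "D * f c \<in> J" by simp_all
  then show "\<forall>s\<in>{a, a + d, a + d + e}. f s \<in> J"
    using regularsD[OF D] fW unfolding set_eq by auto
qed

text \<open>By Fourier inversion, a vector supported on \<open>S\<close> whose transform vanishes on \<open>S\<close>
  corresponds to one supported on the complement whose inverse transform vanishes there.\<close>

lemma kernel_free_complement:
  assumes x: "root_of_order m x" "m > 0" "x \<in> multipliers"
    and y: "root_of_order m y" "y * x = 1" "y \<in> multipliers"
    and m: "of_nat m \<in> regulars"
    and S: "S \<subseteq> {..<m}"
    and free: "kernel_free y ({..<m} - S)"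
  shows "kernel_free x S"
  unfolding kernel_free_def
proof (intro allI impI)
  fix c
  assume cW: "\<forall>s\<in>S. c s \<in> W" and cJ: "\<forall>r\<in>S. (\<Sum>s\<in>S. x ^ (r * s) * c s) \<in> J"
  define d where "d r = (\<Sum>s\<in>S. x ^ (r * s) * c s)" for r
  have dW: "d r \<in> W" for r
    unfolding d_def using cW x by (intro kernel_free_root_sum) auto
  \<comment> \<open>Orthogonality of characters: the sum is geometric with ratio
    \<open>y ^ t * x ^ s\<close>, an \<open>m\<close>-th root of unity that is 1 only for
    \<open>s = t\<close>.\<close>
  have orth: "(\<Sum>r<m. y ^ (r * t) * x ^ (r * s)) = (if s = t then of_nat m else 0)"
    if "s < m" "t < m" for s t
  proof -
    have "y ^ t * x ^ s = 1 \<longleftrightarrow> s = t"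
    proof -
      have "y ^ t * x ^ t = 1"
        by (metis y(2) power_mult_distrib power_one)
      then have "y ^ t * x ^ s = 1 \<longleftrightarrow> x ^ s = x ^ t"
        by (metis mult.left_commute mult.commute mult_1_right)
      also have "\<dots> \<longleftrightarrow> s = t"
        using root_of_order_eq_iff[OF x(1,2)] that zdvd_imp_le[of "int m" "int s - int t"]
          zdvd_imp_le[of "int m" "int t - int s"]
        by (cases s t rule: linorder_cases) (auto simp: dvd_diff_commute)
      finally show ?thesis .
    qed
    moreover have "(y ^ t * x ^ s) ^ m = 1"
        using root_of_order_power[OF x(1)] root_of_order_power[OF y(1)]
      by (simp add: power_mult_distrib power_commutes flip: power_mult) (simp add: mult.commute[of _ m] power_mult)
    moreover have "(\<Sum>r<m. y ^ (r * t) * x ^ (r * s)) = (\<Sum>r<m. (y ^ t * x ^ s) ^ r)"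
      by (simp add: power_mult_distrib mult.commute flip: power_mult)
    ultimately show ?thesis
      using sum_powers_root[of "y ^ t * x ^ s" m] by auto
  qed
  have inv: "(\<Sum>r<m. y ^ (r * t) * d r) = (if t \<in> S then of_nat m * c t else 0)" if "t < m" for t
  proof -
    have "(\<Sum>r<m. y ^ (r * t) * d r) = (\<Sum>s\<in>S. (\<Sum>r<m. y ^ (r * t) * x ^ (r * s)) * c s)"
      unfolding d_def sum_distrib_left sum_distrib_right by (subst sum.swap) (simp add: mult.assoc)
    also have "\<dots> = (\<Sum>s\<in>S. if s = t then of_nat m * c s else 0)"
      using S that by (intro sum.cong) (auto simp: orth)
    also have "\<dots> = (if t \<in> S then of_nat m * c t else 0)"
      using finite_subset[OF S] by simp
    finally show ?thesis .
  qed
  have split: "(\<Sum>r<m. f r) = (\<Sum>r\<in>{..<m} - S. f r) + (\<Sum>r\<in>S. f r)" for f :: "nat \<Rightarrow> 'a"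
    using S by (simp add: sum.subset_diff)
  have dS: "(\<Sum>r\<in>S. y ^ (r * t) * d r) \<in> J" for t
    using cJ y(3) by (intro sum_J multipliers_J multipliers_power) (auto simp: d_def)
  \<comment> \<open>For \<open>t\<close> outside \<open>S\<close> the full inverse transform of
    \<open>d\<close> is zero, so its part over the complement is minus its part over
    \<open>S\<close>, where \<open>d\<close> lies in \<open>J\<close>.\<close>
  have "\<forall>t\<in>{..<m} - S. (\<Sum>r\<in>{..<m} - S. y ^ (t * r) * d r) \<in> J"
  proof
    fix t assume t: "t \<in> {..<m} - S"
    then have "(\<Sum>r\<in>{..<m} - S. y ^ (r * t) * d r) = 0 - (\<Sum>r\<in>S. y ^ (r * t) * d r)"
      using inv[of t] split[of "\<lambda>r. y ^ (r * t) * d r"] by (simp add: eq_neg_iff_add_eq_0)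
    also have "\<dots> \<in> J" by (intro diff_J zero_J dS)
    finally show "(\<Sum>r\<in>{..<m} - S. y ^ (t * r) * d r) \<in> J" by (simp add: mult.commute)
  qed
  then have d: "\<forall>r\<in>{..<m} - S. d r \<in> J"
    using free dW unfolding kernel_free_def by blast
  show "\<forall>s\<in>S. c s \<in> J"
  proof
    fix s assume s: "s \<in> S"
    then have "of_nat m * c s = (\<Sum>r<m. y ^ (r * s) * d r)"
      using inv[of s] S by auto
    also have "\<dots> = (\<Sum>r\<in>{..<m} - S. y ^ (r * s) * d r) + (\<Sum>r\<in>S. y ^ (r * s) * d r)"
      by (rule split)
    also have "\<dots> \<in> J"
      using d y(3) by (intro add_J dS sum_J multipliers_J multipliers_power) auto
    finally show "c s \<in> J"
      using regularsD[OF m] cW s by blast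
  qed
qed

text \<open>The power \<open>x ^ k\<close> is an \<open>m\<close>-th root of unity other than 1, so
  \<open>x ^ k - 1\<close> divides the regular element \<open>m\<close>.\<close>

lemma regulars_root_diff:
  assumes x: "root_of_order m x" "x \<in> multipliers" and m: "of_nat m \<in> regulars" and k: "\<not> m dvd k"
  shows "x ^ k - 1 \<in> regulars"
proof -
  have "(x ^ k) ^ m = 1" "x ^ k \<noteq> 1"
    using x(1) k by (auto simp: root_of_order_def simp flip: power_mult)
  from one_minus_root_dvd_order[OF this]
  have "of_nat m = - (\<Sum>j<m. \<Sum>i<j. (x ^ k) ^ i) * (x ^ k - 1)"
    by (simp add: algebra_simps)
  then show ?thesis
    using m x by (intro regulars_factor[of "- (\<Sum>j<m. \<Sum>i<j. (x ^ k) ^ i)" "x ^ k - 1"])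
      (auto intro!: multipliers_intros simp del: mult_minus_left)
qed

section \<open>Regularity of the minors of size three for orders 6 and 7\<close>

lemma poly_of_int_multiplier: "x \<in> multipliers \<Longrightarrow> poly (map_poly of_int p) x \<in> multipliers"
  unfolding poly_altdef by (auto simp: coeff_map_poly intro!: multipliers_intros)

text \<open>The polynomials \<open>u\<close> and \<open>w\<close> below are Bezout certificates: \<open>u\<close> inverts the minor, up to the
  integer \<open>n\<close>, modulo the polynomial \<open>z\<close> annihilating the root of unity \<open>x\<close>.\<close>

lemma triple_minor_certificate:
  fixes u w z :: "int poly"
  assumes xm: "x ^ m = 1" and x: "x \<in> multipliers" and n: "of_int n \<in> regulars"
    and root: "poly (map_poly of_int z) x = 0"
    and identity: "(monom 1 (((d + e) * (d + e)) mod m) + monom 2 ((d * e) mod m) - 1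
      - monom 1 ((d * d + 2 * d * e) mod m) - monom 1 ((e * e + 2 * d * e) mod m)) * u = [:n:] + w * z"
      (is "?a * u = _")
  shows "triple_minor x d e \<in> regulars"
proof -
  have red: "x ^ (k mod m) = x ^ k" for k
    using xm by (rule power_mod_exponent)
  have minor: "triple_minor x d e = poly (map_poly of_int ?a) x"
    by (simp add: triple_minor_def power2_eq_square of_int_poly_hom.hom_add of_int_poly_hom.hom_minus
        map_poly_monom poly_monom red)
  have "map_poly of_int u * map_poly of_int ?a
      = [:of_int n:] + map_poly of_int w * (map_poly of_int z :: 'a poly)"
    unfolding of_int_poly_hom.hom_mult[symmetric] mult.commute[of u] identity
    by (simp add: of_int_poly_hom.hom_add of_int_hom.map_poly_pCons_hom)
  then have "poly (map_poly of_int u) x * poly (map_poly of_int ?a) x = of_int n"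
    using root by (metis poly_mult poly_add mult_zero_right add_0_right poly_const_conv)
  then have "poly (map_poly of_int u) x * triple_minor x d e \<in> regulars"
    unfolding minor using n by metis
  then show ?thesis
    by (rule regulars_factor) (intro poly_of_int_multiplier triple_minor_multiplier x)+
qed

text \<open>The polynomial \<open>[:1, -1, 1:]\<close> is the sixth cyclotomic polynomial. The
  integer 18 serves all six pairs and has only the prime factors of 6, so it is regular whenever 6
  is.\<close>

lemma triple_regular_6:
  assumes xm: "x ^ 6 = 1" and x: "x \<in> multipliers"
    and root: "poly (map_poly of_int [:1, -1, 1:]) x = 0"
    and reg: "of_int 18 \<in> regulars" and de: "0 < d" "d \<le> e" "d + e < 6"
  shows "triple_minor x d e \<in> regulars"
proof -
  note certificate = triple_minor_certificate[OF xm x reg root]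
  have "d \<in> {1, 2}"
    using de by auto
  then have "d = 1 \<and> e \<in> {1, 2, 3, 4} \<or> d = 2 \<and> e \<in> {2, 3}"
    using de by (elim insertE) auto
  then consider "d = 1" "e = 1" | "d = 1" "e = 2" | "d = 1" "e = 3" | "d = 1" "e = 4" | "d = 2" "e = 2" | "d = 2" "e = 3"
    by blast
  then show ?thesis
  proof cases
    case 1
    show ?thesis unfolding 1
      by (rule certificate[where u = "[:12, -6:]" and w = "[:-30, 0, 18, -6:]"])
        (simp add: monom_Suc monom_0 monom_small one_pCons)
  next
    case 2
    show ?thesis unfolding 2
      by (rule certificate[where u = "[:-3, -3:]" and w = "[:-15, -12, 0, 6, 3:]"])
        (simp add: monom_Suc monom_0 monom_small one_pCons)
  next
    case 3
    show ?thesis unfolding 3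
      by (rule certificate[where u = "[:-6, 3:]" and w = "[:-12, -9, 0, 3:]"])
        (simp add: monom_Suc monom_0 monom_small one_pCons)
  next
    case 4
    show ?thesis unfolding 4
      by (rule certificate[where u = "[:-12, 6:]" and w = "[:6, -18, -18, 12:]"])
        (simp add: monom_Suc monom_0 monom_small one_pCons)
  next
    case 5
    show ?thesis unfolding 5
      by (rule certificate[where u = "[:-4, 2:]" and w = "[:-6, -12, -6, 6:]"])
        (simp add: monom_Suc monom_0 monom_small one_pCons)
  next
    case 6
    show ?thesis unfolding 6
      by (rule certificate[where u = "[:6, -3:]" and w = "[:-12, -9, 0, 3:]"])
        (simp add: monom_Suc monom_0 monom_small one_pCons)
  qed
qed

text \<open>The annihilating polynomial is the seventh cyclotomic one. The factor 2 of 14 is the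
  origin of the restriction \<open>p \<noteq> 2\<close> for \<open>m = 7\<close>.\<close>

lemma triple_regular_7:
  assumes xm: "x ^ 7 = 1" and x: "x \<in> multipliers"
    and root: "poly (map_poly of_int [:1, 1, 1, 1, 1, 1, 1:]) x = 0"
    and reg: "of_int 14 \<in> regulars" and de: "0 < d" "d \<le> e" "d + e < 7"
  shows "triple_minor x d e \<in> regulars"
proof -
  note certificate = triple_minor_certificate[OF xm x reg root]
  have "d \<in> {1, 2, 3}"
    using de by auto
  then have "d = 1 \<and> e \<in> {1, 2, 3, 4, 5} \<or> d = 2 \<and> e \<in> {2, 3, 4} \<or> d = 3 \<and> e \<in> {3}"
    using de by (elim insertE) auto
  then consider "d = 1" "e = 1" | "d = 1" "e = 2" | "d = 1" "e = 3" | "d = 1" "e = 4" | "d = 1" "e = 5" | "d = 2" "e = 2" | "d = 2" "e = 3" | "d = 2" "e = 4" | "d = 3" "e = 3"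
    by blast
  then show ?thesis
  proof cases
    case 1
    show ?thesis unfolding 1
      by (rule certificate[where u = "[:-2, -2, -6, -6, -8, -4:]" and w = "[:-12, 10, 4, -4:]"])
        (simp add: monom_Suc monom_0 monom_small one_pCons)
  next
    case 2
    show ?thesis unfolding 2
      by (rule certificate[where u = "[:0, 1, 0, 1, 1, 4:]" and w = "[:-14, 13, 0, 3, -4:]"])
        (simp add: monom_Suc monom_0 monom_small one_pCons)
  next
    case 3
    show ?thesis unfolding 3
      by (rule certificate[where u = "[:-6, 0, -2, -4, 2, -4:]" and w = "[:-2, 8, -8:]"])
        (simp add: monom_Suc monom_0 monom_small one_pCons)
  next
    case 4
    show ?thesis unfolding 4
      by (rule certificate[where u = "[:-1, 0, 0, 3, -1, -1:]" and w = "[:-13, 13, 1, -3:]"])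
        (simp add: monom_Suc monom_0 monom_small one_pCons)
  next
    case 5
    show ?thesis unfolding 5
      by (rule certificate[where u = "[:-2, 2, 6, 4, 4:]" and w = "[:-10, 4, -4, 8:]"])
        (simp add: monom_Suc monom_0 monom_small one_pCons)
  next
    case 6
    show ?thesis unfolding 6
      by (rule certificate[where u = "[:2, -2, -4, 4, 2, -2:]" and w = "[:-16, 18, 4, -12, 4:]"])
        (simp add: monom_Suc monom_0 monom_small one_pCons)
  next
    case 7
    show ?thesis unfolding 7
      by (rule certificate[where u = "[:-2, 6, 4, 0, 2, 4:]" and w = "[:-10, -2, 6, 0, -4, 8:]"])
        (simp add: monom_Suc monom_0 monom_small one_pCons)
  next
    case 8
    show ?thesis unfolding 8
      by (rule certificate[where u = "[:-4, -4, -3, -4, -3, -3:]" and w = "[:-10, 2, -1, 4, 0, 3:]"])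
        (simp add: monom_Suc monom_0 monom_small one_pCons)
  next
    case 9
    show ?thesis unfolding 9
      by (rule certificate[where u = "[:4, -2, 4, 2, 0, 6:]" and w = "[:-18, 24, -4, -4, 12, -12:]"])
        (simp add: monom_Suc monom_0 monom_small one_pCons)
  qed
qed

lemma triple_minor_regular:
  assumes x: "root_of_order m x" "x \<in> multipliers" and m: "of_nat m \<in> regulars"
    and small: "m = 6 \<or> m = 7 \<and> 2 \<in> regulars" and de: "0 < d" "0 < e" "d + e < m"
  shows "triple_minor x d e \<in> regulars"
proof -
  \<comment> \<open>By symmetry in the two gaps, certificates for \<open>d \<le> e\<close>
    suffice.\<close>
  have *: "triple_minor x d e \<in> regulars" if de: "0 < d" "d \<le> e" "d + e < m" for d e
    using small
  proof
    assume m6: "m = 6"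
    have order: "x ^ 2 \<noteq> 1" "x ^ 3 \<noteq> 1" "x ^ 6 = 1"
      using x(1) unfolding root_of_order_def m6 by auto
    \<comment> \<open>The root must come from the last factor: \<open>x ^ 3\<close> is not 1, and
      \<open>x = -1\<close> would give \<open>x ^ 2 = 1\<close>.\<close>
    have "(x ^ 3 - 1) * (x + 1) * (1 - x + x ^ 2) = x ^ 6 - 1"
      by (simp add: algebra_simps eval_nat_numeral)
    moreover have "x + 1 \<noteq> 0"
      using order(1) by (metis eq_neg_iff_add_eq_0 power2_minus one_power2)
    ultimately have "1 - x + x ^ 2 = 0"
      using order by simp
    then have "poly (map_poly of_int [:1, - 1, 1:]) x = 0"
      by (simp add: map_poly_pCons power2_eq_square algebra_simps)
    \<comment> \<open>From \<open>6 * 6 = 2 * 18\<close>.\<close>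
    moreover have "of_int 18 \<in> regulars"
      by (rule regulars_factor[of 2]) (use m m6 regulars_mult[of 6 6] multipliers_numeral in simp_all)
    ultimately show ?thesis
      using triple_regular_6[OF order(3) x(2)] de m6 by blast
  next
    assume m7: "m = 7 \<and> 2 \<in> regulars"
    then have "(\<Sum>k<7. x ^ k) = 0"
      using x(1) by (intro sum_powers_root) (auto simp: root_of_order_def dest: spec[of _ 1])
    then have "poly (map_poly of_int [:1, 1, 1, 1, 1, 1, 1:]) x = 0"
      by (simp add: map_poly_pCons eval_nat_numeral algebra_simps)
    moreover have "of_int 14 \<in> regulars"
      using regulars_mult[of 2 7] m m7 by simp
    moreover have "x ^ 7 = 1"
      using root_of_order_power[OF x(1)] m7 by simp
    ultimately show ?thesis
      using triple_regular_7[OF _ x(2)] de m7 by blast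
  qed
  show ?thesis
    using *[of d e] *[of e d] de triple_minor_commute[of x d e] by (cases "d \<le> e") simp_all
qed

section \<open>All principal submatrices of the Fourier matrix of order \<open>m\<close>\<close>

lemma kernel_free_small:
  assumes x: "root_of_order m x" "x \<in> multipliers" and m: "of_nat m \<in> regulars"
    and cases: "m \<in> {2, 3, 5, 6, 7}" "m = 7 \<Longrightarrow> 2 \<in> regulars"
    and S: "S \<subseteq> {..<m}" "card S \<le> 2 \<or> card S = 3 \<and> m \<in> {6, 7}"
  shows "kernel_free x S"
proof -
  have xm: "x ^ m = 1" "m > 0"
    using x cases by (auto simp: root_of_order_power)
  have fin: "finite S"
    using S finite_subset by blast
  consider "card S = 0" | "card S = 1" | "card S = 2" | "card S = 3" "m = 6 \<or> m = 7 \<and> 2 \<in> regulars"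
    using S(2) cases(2) by fastforce
  then show ?thesis
  proof cases
    case 1
    then show ?thesis using fin by (simp add: kernel_free_def)
  next
    case 2
    then show ?thesis using kernel_free_1[OF xm x(2)] by (auto simp: card_1_singleton_iff)
  next
    case 3
    then obtain a b where ab: "S = {a, b}" "a < b"
      by (metis card_2_iff insert_commute linorder_neqE_nat)
    define d where "d = b - a"
    have d: "0 < d" "d < m"
      using ab S by (auto simp: d_def)
    have "d = 1 \<or> d = 2 \<or> d = 3 \<or> d = 4 \<or> d = 5 \<or> d = 6"
      using d cases(1) by auto
    then have "\<not> m dvd d ^ 2"
      using d(2) cases(1) by (elim disjE insertE) auto
    then show ?thesis
      unfolding ab(1) using ab(2) regulars_root_diff[OF x m] d_def
      by (intro kernel_free_2[OF xm x(2)]) auto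
  next
    case 4
    define a where "a = Min S"
    have a: "a \<in> S" "\<And>s. s \<in> S \<Longrightarrow> a \<le> s"
      using fin 4 by (auto simp: a_def intro!: Min_in)
    have "card (S - {a}) = 2"
      using fin 4 a by simp
    then obtain b c where bc: "S - {a} = {b, c}" "b < c"
      by (metis card_2_iff insert_commute linorder_neqE_nat)
    have "a < b"
      using a(2)[of b] bc by (metis DiffD1 DiffD2 insertI1 le_neq_implies_less singletonI)
    then obtain d e where de: "b = a + d" "d > 0" "c = a + d + e" "e > 0"
      using bc(2) less_imp_add_positive by metis
    have S_eq: "S = {a, a + d, a + d + e}"
      using bc a de by auto
    show ?thesis
      unfolding S_eq
      using S S_eq de by (intro kernel_free_3[OF xm x(2)] triple_minor_regular[OF x m 4(2)]) auto
  qed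
qed

text \<open>Either \<open>S\<close> or its complement has at most two elements, or at most three
  when \<open>m\<close> is 6 or 7. In the second case the direct argument is applied to the inverse
  root and transferred by Fourier inversion.\<close>

lemma kernel_free_all:
  assumes x: "root_of_order m x" "x \<in> multipliers" and m: "of_nat m \<in> regulars"
    and cases: "m \<in> {2, 3, 5, 6, 7}" "m = 7 \<Longrightarrow> 2 \<in> regulars"
    and S: "S \<subseteq> {..<m}"
  shows "kernel_free x S"
proof (cases "card S \<le> 2 \<or> card S = 3 \<and> m \<in> {6, 7}")
  case True
  then show ?thesis
    using kernel_free_small[OF x m cases S] by blast
next
  case False
  have m0: "m > 0"
    using cases by auto
  obtain y where y: "root_of_order m y" "y * x = 1" "y = x ^ (m - 1)"
    using root_of_order_inverse[OF x(1) m0] .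
  have ym: "y \<in> multipliers"
    unfolding y(3) by (intro multipliers_power x)
  have "card ({..<m} - S) = m - card S"
    using S by (simp add: card_Diff_subset finite_subset)
  then have "card ({..<m} - S) \<le> 2 \<or> card ({..<m} - S) = 3 \<and> m \<in> {6, 7}"
    using False cases(1) by auto
  then have "kernel_free y ({..<m} - S)"
    by (intro kernel_free_small[OF y(1) ym m cases]) auto
  then show ?thesis
    using kernel_free_complement[OF x(1) m0 x(2) y(1,2) ym m S] by blast
qed

section \<open>Kernel vectors modulo \<open>J\<close>\<close>

text \<open>As \<open>p\<close> is a multiple of \<open>1 - \<omega>\<close>, it annihilates the
  quotient of \<open>W\<close> by \<open>J\<close>, on which integers prime to \<open>p\<close> are
  therefore invertible.\<close>

lemma regulars_of_int:
  assumes p: "prime p" and \<omega>: "root_of_order p \<omega>" "\<omega> \<in> multipliers"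
    and \<omega>J: "\<And>w. w \<in> W \<Longrightarrow> (1 - \<omega>) * w \<in> J"
    and k: "\<not> int p dvd k"
  shows "of_int k \<in> regulars"
  unfolding regulars_def
proof (intro CollectI conjI ballI impI)
  fix w assume w: "w \<in> W" "of_int k * w \<in> J"
  have "\<omega> \<noteq> 1"
    using \<omega>(1) p unfolding root_of_order_def by (metis not_prime_1 nat_dvd_1_iff_1 power_one_right)
  then have "of_nat p * w = (1 - \<omega>) * ((\<Sum>k<p. \<Sum>i<k. \<omega> ^ i) * w)"
    using one_minus_root_dvd_order[of \<omega> p] root_of_order_power[OF \<omega>(1)] by (simp add: mult.assoc)
  also have "\<dots> \<in> J"
    using w \<omega> by (intro \<omega>J multipliers_W multipliers_sum multipliers_power)
  finally have pw: "of_nat p * w \<in> J" .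
  have "coprime (int p) k"
    using p k by (simp add: prime_imp_coprime)
  then obtain a b where "a * int p + b * k = 1"
    by (metis bezout_int coprime_imp_gcd_eq_1)
  then have "of_int (a * int p + b * k) * w = w"
    by simp
  then have "w = of_int a * (of_nat p * w) + of_int b * (of_int k * w)"
    by (simp add: algebra_simps)
  also have "\<dots> \<in> J"
    by (intro add_J multipliers_J multipliers_of_int pw w)
  finally show "w \<in> J" .
qed (rule multipliers_of_int)

text \<open>The residue classes modulo \<open>m\<close> split a kernel vector into \<open>m\<close> sparse polynomials. Their
  moments of order \<open>n\<close> at the classes with more than \<open>n\<close> elements form, modulo \<open>J\<close>, a kernel vector of
  a principal submatrix of the Fourier matrix of order \<open>m\<close>; the other classes are settled by the
  moments of lower order.\<close>

lemma fourier_kernel_mod: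
  assumes p: "prime p" and m: "m > 0" "coprime m p"
    and \<eta>: "root_of_order m \<eta>" "\<eta> \<in> multipliers"
    and \<omega>: "root_of_order p \<omega>" "\<omega> \<in> multipliers"
    and \<omega>J: "\<And>w. w \<in> W \<Longrightarrow> (1 - \<omega>) * w \<in> J"
    and free: "\<And>S. S \<subseteq> {..<m} \<Longrightarrow> kernel_free \<eta> S"
    and K: "K \<subseteq> {..<m * p}"
    and vW: "\<And>j. j \<in> K \<Longrightarrow> v j \<in> W"
    and kernel: "\<And>i. i \<in> K \<Longrightarrow> (\<Sum>j\<in>K. (\<eta> * \<omega>) ^ (i * j) * v j) = 0"
    and j: "j \<in> K"
  shows "v j \<in> J"
proof -
  define C where "C s = {j \<in> K. j mod m = s}" for s
  define \<mu> where "\<mu> s n = (\<Sum>j\<in>C s. v j * of_nat j ^ n)" for s n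
  have finK: "finite K"
    using K finite_subset by blast
  then have finC: "finite (C s)" for s
    by (simp add: C_def)
  have p0: "p > 0"
    using p prime_gt_0_nat by blast
  \<comment> \<open>Elements of one class agree modulo \<open>m\<close>; if they also agreed modulo
    \<open>p\<close>, they would agree modulo \<open>m * p\<close> and be equal.\<close>
  have distinct: "\<not> int p dvd int i - int j" if "i \<in> C s" "j \<in> C s" "i \<noteq> j" for i j s
  proof
    assume "int p dvd int i - int j"
    moreover have "int m dvd int i - int j"
      using that by (simp add: C_def flip: mod_eq_dvd_iff of_nat_mod)
    ultimately have "int (m * p) dvd int i - int j"
      using m(2) by (simp add: divides_mult)
    moreover have "\<bar>int i - int j\<bar> < int (m * p)"
    proof -
      have "i < m * p" "j < m * p" using that K by (auto simp: C_def)
      then show ?thesis by linarith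
    qed
    ultimately show False
      using that(3) dvd_imp_le_int[of "int i - int j" "int (m * p)"] by auto
  qed
  have vmuW: "\<mu> s n \<in> W" for s n
    unfolding \<mu>_def
  proof (rule sum_W)
    fix i assume "i \<in> C s"
    then have "of_nat i ^ n * v i \<in> W"
      by (intro multipliers_W multipliers_power multipliers_of_nat vW) (simp add: C_def)
    then show "v i * of_nat i ^ n \<in> W" by (simp add: mult.commute)
  qed
  \<comment> \<open>A Vandermonde argument with the integers \<open>j\<close> themselves as nodes:
    within a class their differences are prime to \<open>p\<close>, hence regular.\<close>
  have exhausted: "v j \<in> J" if "\<And>n. n < card (C s) \<Longrightarrow> \<mu> s n \<in> J" "j \<in> C s" for s j
  proof (rule vandermonde_mod[where A = "C s" and x = of_nat])
    fix i j assume "i \<in> C s" "j \<in> C s" "i \<noteq> j"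
    then show "of_nat i - of_nat j \<in> regulars"
      using regulars_of_int[OF p \<omega> \<omega>J distinct[of i s j]] by simp
  qed (use that finC vW in \<open>auto simp: C_def \<mu>_def multipliers_of_nat\<close>)
  \<comment> \<open>The polynomial \<open>h\<close> has the distinct roots
    \<open>\<omega> ^ i\<close> for \<open>i\<close> in \<open>C r\<close>, so its moments below
    their number lie in \<open>J\<close>. Grouping \<open>j\<close> by residue modulo
    \<open>m\<close> turns these into transforms of \<open>\<mu>\<close>.\<close>
  have transform: "(\<Sum>s<m. \<eta> ^ (r * s) * \<mu> s n) \<in> J" if n: "n < card (C r)" for r n
  proof -
    define h where "h = (\<Sum>j\<in>K. monom (\<eta> ^ (r * j) * v j) j)"
    have coeff_h: "coeff h i = (if i \<in> K then \<eta> ^ (r * i) * v i else 0)" for i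
      using finK by (simp add: h_def coeff_sum)
    have "(\<Sum>j\<le>m * p. coeff h j * of_nat j ^ n) \<in> J"
    proof (rule moments_vanish_mod[where Y = "(\<lambda>i. \<omega> ^ i) ` C r"])
      show "finite ((\<lambda>i. \<omega> ^ i) ` C r)" using finC by simp
      show "y \<in> multipliers" if "y \<in> (\<lambda>i. \<omega> ^ i) ` C r" for y
        using that \<omega> by (auto intro: multipliers_power)
      show "(1 - y) * w \<in> J" if y: "y \<in> (\<lambda>i. \<omega> ^ i) ` C r" and w: "w \<in> W" for y w
      proof -
        obtain i where "y = \<omega> ^ i" using y by auto
        then have "(1 - y) * w = (\<Sum>l<i. \<omega> ^ l) * ((1 - \<omega>) * w)"
          by (simp add: one_diff_power_eq)
        also have "\<dots> \<in> J"
          using \<omega> w by (intro multipliers_J multipliers_sum multipliers_power \<omega>J)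
        finally show ?thesis .
      qed
      show "coeff h i \<in> W" for i
        using \<eta> by (simp add: coeff_h zero_W multipliers_W multipliers_power vW)
      show "poly h y = 0" if y: "y \<in> (\<lambda>i. \<omega> ^ i) ` C r" for y
      proof -
        obtain i where i: "y = \<omega> ^ i" "i \<in> C r" using y by auto
        have "\<eta> ^ (r * j) = \<eta> ^ (i * j)" for j
        proof -
          have "\<eta> ^ r = \<eta> ^ i"
            using i(2) power_mod_exponent[OF root_of_order_power[OF \<eta>(1)], of i] by (simp add: C_def)
          then show ?thesis by (simp add: power_mult)
        qed
        then have "\<eta> ^ (r * j) * v j * (\<omega> ^ i) ^ j = (\<eta> * \<omega>) ^ (i * j) * v j" for j
          unfolding power_mult_distrib power_mult[of \<omega> i j] by (simp only: mult_ac)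
        then have "poly h y = (\<Sum>j\<in>K. (\<eta> * \<omega>) ^ (i * j) * v j)"
          unfolding h_def poly_sum poly_monom i(1) by (simp only:)
        then show ?thesis
          using kernel[of i] i(2) by (simp add: C_def)
      qed
      show "degree h \<le> m * p"
        by (rule degree_le) (use K in \<open>auto simp: coeff_h\<close>)
      have "inj_on (\<lambda>i. \<omega> ^ i) (C r)"
        by (rule inj_onI) (use distinct root_of_order_eq_iff[OF \<omega>(1) p0] in blast)
      then show "n < card ((\<lambda>i. \<omega> ^ i) ` C r)"
        using n by (simp add: card_image)
    qed
    also have "(\<Sum>j\<le>m * p. coeff h j * of_nat j ^ n) = (\<Sum>j\<in>K. \<eta> ^ (r * j) * v j * of_nat j ^ n)"
      using K by (intro sum.mono_neutral_cong_right) (auto simp: coeff_h)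
    also have "\<dots> = (\<Sum>s<m. \<Sum>j\<in>C s. \<eta> ^ (r * j) * v j * of_nat j ^ n)"
      unfolding C_def using finK m(1) by (intro sum.group[symmetric]) auto
    also have "\<dots> = (\<Sum>s<m. \<eta> ^ (r * s) * \<mu> s n)"
    proof (rule sum.cong)
      fix s
      have "\<eta> ^ (r * j) = \<eta> ^ (r * s)" if "j \<in> C s" for j
      proof -
        have "\<eta> ^ j = \<eta> ^ s"
          using that power_mod_exponent[OF root_of_order_power[OF \<eta>(1)], of j] by (simp add: C_def)
        then show ?thesis by (simp only: mult.commute[of r] power_mult)
      qed
      then show "(\<Sum>j\<in>C s. \<eta> ^ (r * j) * v j * of_nat j ^ n) = \<eta> ^ (r * s) * \<mu> s n"
        by (simp add: \<mu>_def sum_distrib_left mult.assoc)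
    qed simp
    finally show ?thesis .
  qed
  have "\<forall>s<m. \<mu> s n \<in> J" for n
  proof (induction n rule: less_induct)
    case (less n)
    define S where "S = {s. s < m \<and> n < card (C s)}"
    have S: "S \<subseteq> {..<m}" by (auto simp: S_def)
    \<comment> \<open>A class with at most \<open>n\<close> elements already has enough moments in
      \<open>J\<close> by induction, so all its entries are in \<open>J\<close>.\<close>
    have outside: "\<mu> s n \<in> J" if "s \<in> {..<m} - S" for s
    proof -
      have s: "s < m" "card (C s) \<le> n"
        using that by (auto simp: S_def)
      have "v j \<in> J" if "j \<in> C s" for j
      proof (rule exhausted[OF _ that])
        fix l assume "l < card (C s)"
        then show "\<mu> s l \<in> J"
          using less.IH[of l] s by simp
      qed
      then have "of_nat j ^ n * v j \<in> J" if "j \<in> C s" for j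
        using that by (intro multipliers_J multipliers_power multipliers_of_nat)
      then show ?thesis
        unfolding \<mu>_def by (intro sum_J) (simp add: mult.commute[of "v _"])
    qed
    have "(\<Sum>s\<in>S. \<eta> ^ (r * s) * \<mu> s n) \<in> J" if "r \<in> S" for r
    proof -
      have "(\<Sum>s\<in>S. \<eta> ^ (r * s) * \<mu> s n)
          = (\<Sum>s<m. \<eta> ^ (r * s) * \<mu> s n) - (\<Sum>s\<in>{..<m} - S. \<eta> ^ (r * s) * \<mu> s n)"
        using S by (simp add: sum_diff)
      also have "\<dots> \<in> J"
        using that \<eta> outside by (intro diff_J transform sum_J multipliers_J multipliers_power) (auto simp: S_def)
      finally show ?thesis .
    qed
    then have "\<forall>s\<in>S. \<mu> s n \<in> J"
      using free[OF S, unfolded kernel_free_def, rule_format, of "\<lambda>s. \<mu> s n"] vmuW by simp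
    then show ?case using outside by auto
  qed
  then show ?thesis
    using exhausted[of "j mod m" j] j m(1) by (simp add: C_def)
qed

end

section \<open>Integer spans and descent\<close>

interpretation int_module: Modules.module "\<lambda>(n::int) (x::'a::comm_ring_1). of_int n * x"
  by unfold_locales (simp_all add: algebra_simps)

lemma int_span_mult:
  fixes x :: "'a::comm_ring_1"
  assumes "\<And>g. g \<in> G \<Longrightarrow> x * g \<in> int_module.span G" "w \<in> int_module.span G"
  shows "x * w \<in> int_module.span G"
  using assms(2)
proof (induction rule: int_module.span_induct_alt)
  case base
  then show ?case by (simp add: int_module.span_zero)
next
  case (step c g y)
  have "x * (of_int c * g + y) = of_int c * (x * g) + x * y"
    by (simp add: algebra_simps)
  then show ?case
    using step assms(1) by (simp add: int_module.span_add int_module.span_scale)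
qed

text \<open>The hypothesis makes \<open>1 / p\<close> an eigenvalue of an integer matrix, hence an algebraic integer,
  unless all generators vanish.\<close>

lemma int_span_divisible_imp_zero:
  fixes G :: "'a::field_char_0 set" and p :: nat
  assumes fin: "finite G" and p: "p > 1"
    and div: "\<And>g. g \<in> G \<Longrightarrow> \<exists>h\<in>int_module.span G. g = of_nat p * h"
    and g: "g \<in> G"
  shows "g = 0"
proof (rule ccontr)
  assume "g \<noteq> 0"
  obtain ws where ws: "set ws = G" "distinct ws"
    using finite_distinct_list[OF fin] by blast
  define n where "n = length ws"
  have "\<exists>a. ws ! i = of_nat p * (\<Sum>j<n. of_int (a j) * ws ! j)" if i: "i < n" for i
  proof -
    have "ws ! i \<in> G"
      using i ws by (auto simp: n_def)
    then obtain h where h: "h \<in> int_module.span G" "ws ! i = of_nat p * h"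
      using div by blast
    obtain u where "h = (\<Sum>x\<in>G. of_int (u x) * x)"
      using h(1) unfolding int_module.span_finite[OF fin] by blast
    also have "\<dots> = (\<Sum>j<n. of_int (u (ws ! j)) * ws ! j)"
      using ws n_def by (intro sum.reindex_bij_betw[symmetric] bij_betw_nth) auto
    finally show ?thesis
      using h(2) by (intro exI[of _ "\<lambda>j. u (ws ! j)"]) simp
  qed
  then obtain a where a: "\<And>i. i < n \<Longrightarrow> ws ! i = of_nat p * (\<Sum>j<n. of_int (a i j) * ws ! j)"
    by metis
  define A where "A = mat n n (\<lambda>(i, j). a i j)"
  let ?A = "map_mat of_int A :: 'a mat"
  define w where "w = vec n (\<lambda>i. ws ! i)"
  have A: "A \<in> carrier_mat n n" "?A \<in> carrier_mat n n"
    by (simp_all add: A_def)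
  have "?A *\<^sub>v w = (1 / of_nat p) \<cdot>\<^sub>v w"
  proof (rule eq_vecI)
    fix i assume "i < dim_vec ((1 / of_nat p) \<cdot>\<^sub>v w)"
    then have i: "i < n" by (simp add: w_def)
    then have "(?A *\<^sub>v w) $ i = (\<Sum>j<n. of_int (a i j) * ws ! j)"
      by (simp add: A_def w_def scalar_prod_def lessThan_atLeast0)
    also have "\<dots> = (1 / of_nat p) * ws ! i"
      using p by (subst a[OF i]) simp
    finally show "(?A *\<^sub>v w) $ i = ((1 / of_nat p) \<cdot>\<^sub>v w) $ i"
      using i by (simp add: w_def)
  qed (simp add: A_def w_def)
  moreover have "w \<noteq> 0\<^sub>v n"
  proof -
    obtain i where "i < n" "g = ws ! i"
      using g ws n_def by (metis in_set_conv_nth)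
    then show ?thesis
      using \<open>g \<noteq> 0\<close> by (metis index_vec index_zero_vec(1) w_def)
  qed
  ultimately have "eigenvector ?A w (1 / of_nat p)"
    using A by (simp add: eigenvector_def w_def)
  then have "poly (char_poly ?A) (1 / of_nat p) = 0"
    using eigenvalue_root_char_poly[OF A(2)] by (auto simp: eigenvalue_def)
  then have "poly (map_poly of_int (char_poly A)) (1 / of_nat p :: 'a) = 0"
    by (simp add: of_int_hom.char_poly_hom[OF A(1)])
  \<comment> \<open>The characteristic polynomial of an integer matrix is monic with integer
    coefficients, and a rational algebraic integer is an integer.\<close>
  then have "algebraic_int (1 / of_nat p :: 'a)"
    unfolding algebraic_int_altdef_ipoly using degree_monic_char_poly[OF A(1)] by auto
  then have "(1 / of_nat p :: 'a) \<in> \<int>"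
    by (rule rational_algebraic_int_is_int) simp
  then obtain k :: int where "(1 / of_nat p :: 'a) = of_int k"
    by (elim Ints_cases)
  then have "(of_int (k * int p) :: 'a) = of_int 1"
    using p by (simp add: field_simps)
  then have "k * int p = 1"
    by (simp only: of_int_eq_iff)
  then show False
    using p by (simp add: zmult_eq_1_iff)
qed

text \<open>The inner binomial coefficients are divisible by \<open>p\<close>. The two outer terms
  add up to \<open>1 + (- 1) ^ p\<close>, which is 0 for odd \<open>p\<close> and 2 for
  \<open>p = 2\<close>.\<close>

lemma one_minus_root_power_divisible:
  fixes x :: "'a::comm_ring_1"
  assumes p: "prime p" and x: "x ^ p = 1"
  obtains c :: "nat \<Rightarrow> int" where "(1 - x) ^ p = of_nat p * (\<Sum>k<p. of_int (c k) * x ^ k)"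
proof -
  have p0: "p > 0"
    using p prime_gt_0_nat by blast
  have "int p dvd 1 + (- 1) ^ p"
  proof (cases "p = 2")
    case False
    then have "odd p"
      using p prime_odd_nat prime_gt_1_nat[OF p] by simp
    then show ?thesis by simp
  qed simp
  then obtain c0 where c0: "1 + (- 1) ^ p = int p * c0"
    by blast
  have "\<exists>b. p choose k = p * b" if "0 < k" "k < p" for k
    using dvd_choose_prime[of k p] that p by (auto elim: dvdE)
  then obtain b where b: "\<And>k. 0 < k \<Longrightarrow> k < p \<Longrightarrow> p choose k = p * b k"
    by metis
  define c where "c k = (if k = 0 then c0 else (- 1) ^ k * int (b k))" for k
  have split: "{..p} = insert p (insert 0 {0<..<p})"
    using p0 by auto
  have split': "{..<p} = insert 0 {0<..<p}"
    using p0 by auto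
  have "(1 - x) ^ p = (\<Sum>k\<le>p. of_nat (p choose k) * (- x) ^ k)"
    using binomial_ring[of "- x" 1 p] by simp
  also have "\<dots> = (- x) ^ p + 1 + (\<Sum>k\<in>{0<..<p}. of_nat (p choose k) * (- x) ^ k)"
    unfolding split using p0 by (simp add: add.assoc)
  also have "(- x) ^ p + 1 = of_int (1 + (- 1) ^ p)"
    by (subst power_minus) (simp add: x)
  also have "\<dots> = of_nat p * of_int (c 0)"
    unfolding c0 by (simp add: c_def)
  also have "(\<Sum>k\<in>{0<..<p}. of_nat (p choose k) * (- x) ^ k)
      = (\<Sum>k\<in>{0<..<p}. of_nat p * (of_int (c k) * x ^ k))"
  proof (rule sum.cong)
    fix k assume "k \<in> {0<..<p}"
    then show "of_nat (p choose k) * (- x) ^ k = of_nat p * (of_int (c k) * x ^ k)"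
      by (subst power_minus) (simp add: b c_def)
  qed simp
  also have "of_nat p * of_int (c 0) + \<dots> = of_nat p * (\<Sum>k<p. of_int (c k) * x ^ k)"
    unfolding split' by (simp add: sum_distrib_left distrib_left)
  finally show ?thesis using that by blast
qed

section \<open>From congruences modulo \<open>J\<close> to vanishing\<close>

lemma fourier_kernel_trivial:
  fixes \<eta> \<omega> :: "'a::field_char_0"
  assumes p: "prime p" and m: "m \<in> {2, 3, 5, 6, 7}" "coprime m p" "m = 7 \<Longrightarrow> p \<noteq> 2"
    and \<eta>: "root_of_order m \<eta>" and \<omega>: "root_of_order p \<omega>"
    and K: "K \<subseteq> {..<m * p}"
    and kernel: "\<And>i. i \<in> K \<Longrightarrow> (\<Sum>j\<in>K. (\<eta> * \<omega>) ^ (i * j) * v j) = 0"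
    and j: "j \<in> K"
  shows "v j = 0"
proof -
  \<comment> \<open>All products with powers of both roots are included, so that the integer span is
    stable under \<open>\<eta>\<close> and \<open>\<omega>\<close> while \<open>G\<close> stays
    finite.\<close>
  define G where "G = (\<lambda>(a, b, j). \<eta> ^ a * \<omega> ^ b * v j) ` ({..<m} \<times> {..<p} \<times> K)"
  define W where "W = int_module.span G"
  define J where "J = (\<lambda>w. (1 - \<omega>) * w) ` W"
  have p1: "p > 1" and m0: "m > 0"
    using p prime_gt_1_nat m(1) by auto
  have finG: "finite G"
    unfolding G_def using K finite_subset by (intro finite_imageI finite_cartesian_product) auto
  have vG: "v j \<in> G" if "j \<in> K" for j
    unfolding G_def using that m0 p1 by (intro image_eqI[of _ _ "(0, 0, j)"]) auto
  have \<eta>W: "\<eta> * w \<in> W" if "w \<in> W" for w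
    using that unfolding W_def
  proof (rule int_span_mult[rotated])
    fix g assume "g \<in> G"
    then obtain a b j where g: "g = \<eta> ^ a * \<omega> ^ b * v j" "b < p" "j \<in> K"
      by (auto simp: G_def)
    have "\<eta> * g = \<eta> ^ (Suc a mod m) * \<omega> ^ b * v j"
      unfolding g power_mod_exponent[OF root_of_order_power[OF \<eta>]] by simp
    then have "\<eta> * g \<in> G"
      unfolding G_def using g m0 by (intro image_eqI[of _ _ "(Suc a mod m, b, j)"]) auto
    then show "\<eta> * g \<in> int_module.span G"
      by (rule int_module.span_base)
  qed
  have \<omega>W: "\<omega> * w \<in> W" if "w \<in> W" for w
    using that unfolding W_def
  proof (rule int_span_mult[rotated])
    fix g assume "g \<in> G"
    then obtain a b j where g: "g = \<eta> ^ a * \<omega> ^ b * v j" "a < m" "j \<in> K"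
      by (auto simp: G_def)
    have "\<omega> * g = \<eta> ^ a * \<omega> ^ (Suc b mod p) * v j"
      unfolding g power_mod_exponent[OF root_of_order_power[OF \<omega>]] by (simp add: mult_ac)
    then have "\<omega> * g \<in> G"
      unfolding G_def using g p1 by (intro image_eqI[of _ _ "(a, Suc b mod p, j)"]) auto
    then show "\<omega> * g \<in> int_module.span G"
      by (rule int_module.span_base)
  qed
  have diffW: "x - y \<in> W" if "x \<in> W" "y \<in> W" for x y
    using that unfolding W_def by (rule int_module.span_diff)
  have W0: "0 \<in> W"
    unfolding W_def by (rule int_module.span_zero)
  interpret submodule_pair W J
  proof
    show "J \<subseteq> W"
      unfolding J_def using diffW \<omega>W by (auto simp: left_diff_distrib)
    show "0 \<in> J"
      unfolding J_def using W0 by (intro image_eqI[of _ _ 0]) simp_all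
    show "x - y \<in> J" if x: "x \<in> J" and y: "y \<in> J" for x y
    proof -
      obtain x' y' where "x = (1 - \<omega>) * x'" "y = (1 - \<omega>) * y'" "x' \<in> W" "y' \<in> W"
        using x y by (auto simp: J_def)
      then have "x - y = (1 - \<omega>) * (x' - y')" "x' - y' \<in> W"
        using diffW by (auto simp: right_diff_distrib)
      then show ?thesis unfolding J_def by blast
    qed
  qed (use diffW in blast)
  \<comment> \<open>A scalar that preserves \<open>W\<close> commutes with
    \<open>1 - \<omega>\<close> and so preserves \<open>J\<close> as well.\<close>
  have multiplierI: "a \<in> multipliers" if "\<And>w. w \<in> W \<Longrightarrow> a * w \<in> W" for a
    unfolding multipliers_def
  proof (intro CollectI conjI ballI)
    fix w assume "w \<in> J"
    then obtain w' where "w' \<in> W" "w = (1 - \<omega>) * w'"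
      by (auto simp: J_def)
    then show "a * w \<in> J"
      unfolding J_def using that by (intro image_eqI[of _ _ "a * w'"]) (simp_all add: mult.left_commute)
  qed (rule that)
  have mult: "\<eta> \<in> multipliers" "\<omega> \<in> multipliers"
    using \<eta>W \<omega>W by (auto intro: multiplierI)
  have \<omega>J: "(1 - \<omega>) * w \<in> J" if "w \<in> W" for w
    using that unfolding J_def by (rule imageI)
  note int_regular = regulars_of_int[OF p \<omega> mult(2) \<omega>J]
  have "\<not> p dvd m"
    using m(2) p1 by (metis coprime_common_divisor_nat dvd_refl less_irrefl)
  then have mreg: "of_nat m \<in> regulars"
    using int_regular[of "int m"] by simp
  have reg2: "2 \<in> regulars" if "m = 7"
  proof -
    have "\<not> p dvd 2"
      using m(3)[OF that] p primes_dvd_imp_eq two_is_prime_nat by blast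
    then have "\<not> int p dvd 2"
      by (metis int_dvd_int_iff of_nat_numeral)
    then show ?thesis
      using int_regular[of 2] by simp
  qed
  have vJ: "v j \<in> J" if "j \<in> K" for j
  proof (rule fourier_kernel_mod[OF p m0 m(2) \<eta> mult(1) \<omega> mult(2) \<omega>J _ K _ kernel that])
    show "kernel_free \<eta> S" if "S \<subseteq> {..<m}" for S
      using kernel_free_all[OF \<eta> mult(1) mreg m(1) reg2 that] by blast
    show "v j \<in> W" if "j \<in> K" for j
      unfolding W_def using vG[OF that] by (rule int_module.span_base)
  qed
  have GJ: "g \<in> J" if "g \<in> G" for g
    using that mult vJ unfolding G_def
    by (auto intro!: multipliers_J multipliers_mult multipliers_power)
  have WJ: "w \<in> J" if "w \<in> W" for w
    using that[unfolded W_def]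
  proof (induction rule: int_module.span_induct_alt)
    case base
    show ?case by (rule zero_J)
  next
    case (step c g y)
    then show ?case
      by (blast intro: add_J multipliers_J multipliers_of_int GJ)
  qed
  \<comment> \<open>Since \<open>W = (1 - \<omega>) W\<close>, any number of factors can be split
    off; \<open>p\<close> of them yield a factor \<open>p\<close>.\<close>
  have iterate: "\<exists>w'\<in>W. w = (1 - \<omega>) ^ n * w'" if "w \<in> W" for w n
  proof (induction n)
    case (Suc n)
    then obtain w' where w': "w' \<in> W" "w = (1 - \<omega>) ^ n * w'" by blast
    obtain w'' where "w'' \<in> W" "w' = (1 - \<omega>) * w''"
      using WJ[OF w'(1)] by (auto simp: J_def)
    then show ?case
      using w'(2) by (intro bexI[of _ w'']) (simp_all add: mult_ac)
  qed (use that in auto)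
  obtain c :: "nat \<Rightarrow> int" where c: "(1 - \<omega>) ^ p = of_nat p * (\<Sum>k<p. of_int (c k) * \<omega> ^ k)"
    using one_minus_root_power_divisible[OF p root_of_order_power[OF \<omega>]] .
  show ?thesis
  proof (rule int_span_divisible_imp_zero[OF finG p1 _ vG[OF j]])
    fix g assume "g \<in> G"
    then have "g \<in> W" unfolding W_def by (rule int_module.span_base)
    then obtain w where w: "w \<in> W" "g = (1 - \<omega>) ^ p * w"
      using iterate by blast
    have "(\<Sum>k<p. of_int (c k) * \<omega> ^ k) * w \<in> W"
      using w(1) mult by (intro multipliers_W) (auto intro!: multipliers_intros)
    then show "\<exists>h\<in>int_module.span G. g = of_nat p * h"
      unfolding w(2) c W_def[symmetric] by (auto simp: mult.assoc)
  qed
qed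

section \<open>The Fourier matrix\<close>

lemma root_of_order_exp:
  assumes "N > 0"
  shows "root_of_order N (exp (- (2 * complex_of_real pi * \<i> / of_nat N)))"
  unfolding root_of_order_def
proof
  fix k
  let ?z = "exp (- (2 * complex_of_real pi * \<i> / of_nat N))"
  have pow: "?z ^ k = cis (- (2 * pi * real k / real N))" for k
    by (simp add: cis_conv_exp exp_of_nat_mult[symmetric] mult_ac)
  have zN: "?z ^ N = 1"
    unfolding pow using assms by (simp add: complex_eq_iff)
  have "?z ^ k = ?z ^ (k mod N)"
    by (simp add: power_mod_exponent[OF zN])
  \<comment> \<open>The sign in the exponent only conjugates the value, which does not affect being
    1.\<close>
  also have "\<dots> = 1 \<longleftrightarrow> cis (2 * pi * real (k mod N) / real N) = cis (2 * pi * real 0 / real N)"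
    unfolding pow by (simp add: complex_eq_iff)
  also have "\<dots> \<longleftrightarrow> k mod N = 0"
  proof
    assume "cis (2 * pi * real (k mod N) / real N) = cis (2 * pi * real 0 / real N)"
    then show "k mod N = 0"
      by (rule inj_onD[OF bij_betw_imp_inj_on[OF bij_betw_roots_unity[OF assms]]]) (use assms in simp_all)
  qed simp
  finally show "?z ^ k = 1 \<longleftrightarrow> N dvd k"
    by (simp add: dvd_eq_mod_eq_0)
qed

text \<open>Chinese remaindering in the exponent: with \<open>p * u\<close> congruent to 1 modulo
  \<open>m\<close> and \<open>m * t\<close> congruent to 1 modulo \<open>p\<close>, the sum
  \<open>p * u + m * t\<close> is congruent to 1 modulo \<open>m * p\<close>.\<close>

lemma root_of_order_split:
  fixes \<zeta> :: "'a::idom"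
  assumes \<zeta>: "root_of_order (m * p) \<zeta>" and mp: "coprime m p" "m > 0" "p > 0"
  obtains \<eta> \<omega> where "root_of_order m \<eta>" "root_of_order p \<omega>" "\<zeta> = \<eta> * \<omega>"
proof -
  have part: "\<exists>u. root_of_order m (\<zeta> ^ (p * u)) \<and> int m dvd int (p * u) - 1"
    if part: "root_of_order (m * p) \<zeta>" "coprime m p" "p > 0" for m p :: nat
  proof -
    have "gcd p m = 1"
      using part(2) by (simp add: coprime_iff_gcd_eq_1 gcd.commute)
    then obtain u y where u: "p * u = m * y + 1"
      using bezout_nat[of p m] part(3) by auto
    have "coprime m u"
      by (rule coprimeI) (metis u dvd_add_right_iff dvd_mult dvd_mult2)
    then have "root_of_order m (\<zeta> ^ (p * u))"
      using part unfolding root_of_order_def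
      by (simp add: mult.assoc mult.commute[of m p] coprime_dvd_mult_right_iff flip: power_mult)
    moreover have "int m dvd int (p * u) - 1"
      unfolding u by simp
    ultimately show ?thesis by blast
  qed
  obtain u where u: "root_of_order m (\<zeta> ^ (p * u))" "int m dvd int (p * u) - 1"
    using part[OF \<zeta> mp(1,3)] by blast
  obtain t where t: "root_of_order p (\<zeta> ^ (m * t))" "int p dvd int (m * t) - 1"
    using part[of p m] \<zeta> mp by (auto simp: mult.commute coprime_commute)
  have "int m dvd (int (p * u) - 1) + int (m * t)" "int p dvd (int (m * t) - 1) + int (p * u)"
    using u(2) t(2) by (intro dvd_add; simp)+
  then have "int m dvd int 1 - int (p * u + m * t)" "int p dvd int 1 - int (p * u + m * t)"
    by (simp_all add: dvd_diff_commute[of _ 1] algebra_simps)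
  then have "int (m * p) dvd int 1 - int (p * u + m * t)"
    using mp(1) by (simp add: divides_mult)
  moreover have "0 < m * p"
    using mp by simp
  ultimately have "\<zeta> ^ 1 = \<zeta> ^ (p * u + m * t)"
    using root_of_order_eq_iff[OF \<zeta>, of 1 "p * u + m * t"] by blast
  then show ?thesis
    using that[OF u(1) t(1)] by (simp add: power_add)
qed

text \<open>The enumeration is strictly increasing, hence injective; counting gives
  surjectivity.\<close>

lemma bij_betw_pick:
  assumes "finite K"
  shows "bij_betw (pick K) {..<card K} K"
proof (rule bij_betw_imageI)
  show "inj_on (pick K) {..<card K}"
    by (rule inj_onI) (metis lessThan_iff linorder_neqE_nat order_less_irrefl pick_mono_le)
  then have "card (pick K ` {..<card K}) = card K"
    by (simp add: card_image)
  moreover have "pick K ` {..<card K} \<subseteq> K"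
    using pick_in_set_le by auto
  ultimately show "pick K ` {..<card K} = K"
    using assms card_subset_eq by blast
qed

lemma det_principal_submatrix_zeroE:
  fixes F :: "'a::field mat"
  assumes F: "F \<in> carrier_mat N N" and K: "K \<subseteq> {0..<N}" and det: "det (submatrix F K K) = 0"
  obtains v k where "\<forall>i\<in>K. (\<Sum>j\<in>K. F $$ (i, j) * v j) = 0" "k \<in> K" "v k \<noteq> 0"
proof -
  define n where "n = card K"
  have fin: "finite K"
    using K finite_subset by blast
  have "{i. i < N \<and> i \<in> K} = K"
    using K by auto
  then have sub: "submatrix F K K = mat n n (\<lambda>(i, j). F $$ (pick K i, pick K j))"
    using F by (simp add: submatrix_def n_def)
  have bij: "bij_betw (pick K) {..<n} K"
    unfolding n_def using fin by (rule bij_betw_pick)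
  obtain w where w: "w \<in> carrier_vec n" "w \<noteq> 0\<^sub>v n" "submatrix F K K *\<^sub>v w = 0\<^sub>v n"
    using det det_0_iff_vec_prod_zero_field[of "submatrix F K K" n] by (auto simp: sub)
  \<comment> \<open>The kernel vector is carried from matrix positions to the elements of
    \<open>K\<close>.\<close>
  define v where "v j = w $ (inv_into {..<n} (pick K) j)" for j
  have v: "v (pick K l) = w $ l" if "l < n" for l
    using that bij by (simp add: v_def bij_betw_def inv_into_f_f)
  have "(\<Sum>j\<in>K. F $$ (i, j) * v j) = 0" if i: "i \<in> K" for i
  proof -
    obtain l where l: "l < n" "i = pick K l"
      using i bij by (auto simp: bij_betw_def)
    have "(\<Sum>j\<in>K. F $$ (i, j) * v j) = (\<Sum>k<n. F $$ (i, pick K k) * v (pick K k))"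
      by (rule sum.reindex_bij_betw[OF bij, symmetric])
    also have "\<dots> = (submatrix F K K *\<^sub>v w) $ l"
      using l w(1) by (simp add: sub scalar_prod_def v lessThan_atLeast0)
    finally show ?thesis
      using w(3) l by simp
  qed
  moreover obtain l where "l < n" "w $ l \<noteq> 0"
    using w(1,2) by (metis carrier_vecD eq_vecI index_zero_vec)
  then have "pick K l \<in> K" "v (pick K l) \<noteq> 0"
    using v bij by (auto simp: bij_betw_def)
  ultimately show ?thesis
    using that by blast
qed

lemma det_principal_fourier_nonzero:
  assumes p: "prime p" and m: "m \<in> {2, 3, 5, 6, 7}" "coprime m p" "m = 7 \<Longrightarrow> p \<noteq> 2"
    and K: "K \<subseteq> {0..<m * p}"
  shows "det (submatrix (fourier_matrix (m * p)) K K) \<noteq> 0"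
proof
  let ?N = "m * p"
  let ?z = "exp (- (2 * complex_of_real pi * \<i> / of_nat ?N))"
  assume det: "det (submatrix (fourier_matrix ?N) K K) = 0"
  have pos: "m > 0" "p > 0"
    using m(1) p prime_gt_0_nat by auto
  have "fourier_matrix ?N \<in> carrier_mat ?N ?N"
    by (simp add: fourier_matrix_def)
  then obtain v k where v: "\<forall>i\<in>K. (\<Sum>j\<in>K. fourier_matrix ?N $$ (i, j) * v j) = 0"
      and k: "k \<in> K" "v k \<noteq> 0"
    using K det by (rule det_principal_submatrix_zeroE)
  have "root_of_order ?N ?z"
    using pos by (intro root_of_order_exp) simp
  then obtain \<eta> \<omega> where roots: "root_of_order m \<eta>" "root_of_order p \<omega>" "?z = \<eta> * \<omega>"
    using m(2) pos by (rule root_of_order_split)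
  have "(\<Sum>j\<in>K. (\<eta> * \<omega>) ^ (i * j) * v j) = 0" if i: "i \<in> K" for i
  proof -
    have "(\<Sum>j\<in>K. (\<eta> * \<omega>) ^ (i * j) * v j) = (\<Sum>j\<in>K. fourier_matrix ?N $$ (i, j) * v j)"
    proof (rule sum.cong)
      fix j assume j: "j \<in> K"
      have "i < ?N" "j < ?N"
        using i j K by auto
      then have entry: "fourier_matrix ?N $$ (i, j) = ?z ^ (i * j)"
        unfolding fourier_matrix_def by (subst index_mat) simp_all
      show "(\<eta> * \<omega>) ^ (i * j) * v j = fourier_matrix ?N $$ (i, j) * v j"
        unfolding entry roots(3) ..
    qed simp
    also have "\<dots> = 0" using v i by (rule bspec)
    finally show ?thesis .
  qed
  then have "v k = 0"
    using K k(1) by (intro fourier_kernel_trivial[OF p m roots(1,2), of K v]) (simp_all add: lessThan_atLeast0)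
  then show False using k(2) by simp
qed

theorem theorem1p3:
  fixes N p :: nat and K :: "nat set"
  assumes "squarefree N"
    and "prime p"
    and "N = 2 * p \<or> N = 3 * p \<or> N = 5 * p \<or> N = 6 * p \<or> N = 7 * p"
    and "K \<subseteq> {0..<N}"
  shows "det (submatrix (fourier_matrix N) K K) \<noteq> 0"
proof -
  obtain m where m: "m \<in> {2, 3, 5, 6, 7}" "N = m * p"
    using assms(3) by auto
  \<comment> \<open>This is where squarefreeness of \<open>N\<close> enters.\<close>
  have "\<not> p dvd m"
  proof
    assume "p dvd m"
    then have "p ^ 2 dvd N"
      unfolding m(2) power2_eq_square by (intro mult_dvd_mono) simp_all
    from squarefreeD[OF assms(1) this] show False
      using assms(2) by simp
  qed
  then have coprime: "coprime m p"
    using prime_imp_coprime[OF assms(2)] by (simp add: coprime_commute)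
  show ?thesis
  proof (cases "m = 7 \<and> p = 2")
    case True
    \<comment> \<open>The excluded case \<open>m = 7\<close>, \<open>p = 2\<close> is read with the
      roles exchanged: \<open>m = 2\<close>, \<open>p = 7\<close>.\<close>
    then have N: "N = 2 * 7" using m(2) by simp
    show ?thesis
      using assms(4) unfolding N by (intro det_principal_fourier_nonzero) simp_all
  next
    case False
    then show ?thesis
      using assms(4) unfolding m(2) by (intro det_principal_fourier_nonzero assms(2) m(1) coprime) auto
  qed
qed

end
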